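(* Let $\alpha>0$ and let $n\ge1$ be an integer. Then for all real $\xi$, the Fourier transform of $E_n(\cdot;\alpha)$ is given by $$\widehat{E_n}(\xi;\alpha)=\widehat{N_{0,n}}(\xi)\,\frac{1}{1-e^{-(\alpha+i\xi)}}.$$
   Context: For $n\ge1$ the uniform B-spline $N_{0,n}$ of order $n$ is $$N_{0,n}(x)=\frac{1}{(n-1)!}\sum_{j=0}^{n}(-1)^j\binom{n}{j}(x-j)_+^{n-1},$$ where $x_+^m:=x^m$ if $x\ge0$ and $x_+^m:=0$ if $x<0$. The exponential B-spline of order $n$ with parameter $\alpha$ is $$E_n(x;\alpha)=\sum_{k=0}^{\infty}e^{-\alpha k}N_{0,n}(x-k).$$ The Fourier transform is $\widehat{f}(\xi)=\int_{\mathbb{R}}f(x)e^{-i\xi x}\,dx$. *)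

theory Defs
  imports "HOL-Analysis.Analysis"
begin

(* For m = 0 this is the indicator of {0..}, since 0 ^ 0 = 1. *)
definition trunc_pow :: "nat \<Rightarrow> real \<Rightarrow> real" where
  "trunc_pow m x = (if 0 \<le> x then x ^ m else 0)"

(* Meaningful for n \<ge> 1 only. *)
definition bspline :: "nat \<Rightarrow> real \<Rightarrow> real" where
  "bspline n x =
     1 / fact (n - 1) * (\<Sum>j = 0..n. (-1) ^ j * real (n choose j) * trunc_pow (n - 1) (x - real j))"

definition exp_bspline :: "nat \<Rightarrow> real \<Rightarrow> real \<Rightarrow> real" where
  "exp_bspline n \<alpha> x = (\<Sum>k. exp (- \<alpha> * real k) * bspline n (x - real k))"

(* The integral is 0 by convention when f is not integrable, so statements about
   fourier_transform f should be accompanied by integrability of f. *)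
definition fourier_transform :: "(real \<Rightarrow> complex) \<Rightarrow> real \<Rightarrow> complex" where
  "fourier_transform f \<xi> = (LINT x|lborel. f x * exp (- \<i> * of_real \<xi> * of_real x))"

end

theory Submission
  imports Defs
begin

text \<open>
  The spline \<open>N\<^sub>0\<^sub>,\<^sub>n\<close> vanishes off \<open>[0, n)\<close>: to the right of \<open>n\<close> it is an \<open>n\<close>-th finite difference
  of a polynomial of degree \<open>n - 1\<close>. Hence it is bounded with compact support, so integrable, the
  series for \<open>E\<^sub>n\<close> is finite at each point and converges in \<open>L\<^sup>1\<close>. Translating by \<open>k\<close> multiplies the
  Fourier transform by \<open>e\<^bsup>-i\<xi>k\<^esup>\<close>, and integrating termwise leaves a geometric series.
\<close>

text \<open>
  Splitting one factor as \<open>x - j\<close> and absorbing \<open>j\<close> into the binomial coefficient expresses the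
  exponent \<open>m + 1\<close>, order \<open>n\<close> difference through exponent \<open>m\<close> and orders \<open>n\<close> and \<open>n - 1\<close>.
\<close>
lemma finite_difference_power_eq_0:
  fixes x :: "'a::comm_ring_1"
  assumes "m < n"
  shows "(\<Sum>j\<le>n. (-1) ^ j * of_nat (n choose j) * (x - of_nat j) ^ m) = 0"
  using assms
proof (induction m arbitrary: n x)
  case 0
  then show ?case
    using choose_alternating_sum[of n, where 'a = 'a] by simp
next
  case (Suc m)
  then obtain p where n: "n = Suc p" and p: "m < p"
    by (cases n) auto
  have absorb: "of_nat (Suc i) * of_nat (Suc p choose Suc i) =
      (of_nat (Suc p) * of_nat (p choose i) :: 'a)" for i
    using Suc_times_binomial[of i p] by (metis of_nat_mult)
  have "(\<Sum>j\<le>n. (-1) ^ j * of_nat (n choose j) * (x - of_nat j) ^ Suc m) =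
      x * (\<Sum>j\<le>n. (-1) ^ j * of_nat (n choose j) * (x - of_nat j) ^ m) -
      (\<Sum>j\<le>n. (-1) ^ j * (of_nat j * of_nat (n choose j)) * (x - of_nat j) ^ m)"
    unfolding sum_distrib_left sum_subtractf[symmetric]
    by (intro sum.cong refl) (simp add: algebra_simps)
  also have "(\<Sum>j\<le>n. (-1) ^ j * of_nat (n choose j) * (x - of_nat j) ^ m) = 0"
    using Suc.IH Suc.prems by simp
  also have "(\<Sum>j\<le>n. (-1) ^ j * (of_nat j * of_nat (n choose j)) * (x - of_nat j) ^ m) =
      (\<Sum>i\<le>p. (-1) ^ Suc i * (of_nat (Suc i) * of_nat (Suc p choose Suc i)) * (x - of_nat (Suc i)) ^ m)"
    unfolding n sum.atMost_Suc_shift by simp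
  \<comment> \<open>The shift j = i + 1 moves the base point to \<open>x - 1\<close> and lowers the
    order to \<open>p\<close>, which is why the induction generalises over both \<open>x\<close> and
    \<open>n\<close>.\<close>
  also have "\<dots> = - of_nat (Suc p) * (\<Sum>i\<le>p. (-1) ^ i * of_nat (p choose i) * ((x - 1) - of_nat i) ^ m)"
    unfolding absorb sum_distrib_left
    by (intro sum.cong refl) (simp add: algebra_simps)
  also have "\<dots> = 0"
    using Suc.IH p by simp
  finally show ?case
    by simp
qed

lemma bspline_eq_0_left: "x < 0 \<Longrightarrow> bspline n x = 0"
  by (simp add: bspline_def trunc_pow_def)

text \<open>Beyond \<open>n\<close> no truncation is active, so the sum is a full finite difference
  of order \<open>n\<close>. At \<open>x = n\<close> the last term still agrees, even for
  \<open>n = 1\<close>, because \<open>0 ^ 0 = 1\<close>.\<close>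

lemma bspline_eq_0_right:
  assumes "n \<ge> 1" "x \<ge> real n"
  shows "bspline n x = 0"
proof -
  have "(\<Sum>j = 0..n. (-1) ^ j * real (n choose j) * trunc_pow (n - 1) (x - real j)) =
      (\<Sum>j\<le>n. (-1) ^ j * real (n choose j) * (x - real j) ^ (n - 1))"
    unfolding atMost_atLeast0 using assms(2) by (intro sum.cong) (auto simp: trunc_pow_def)
  also have "\<dots> = 0"
    using assms(1) by (intro finite_difference_power_eq_0) auto
  finally show ?thesis
    by (simp add: bspline_def)
qed

lemma borel_measurable_bspline [measurable]: "bspline n \<in> borel_measurable borel"
  unfolding bspline_def[abs_def] trunc_pow_def by measurable

lemma bspline_bounded_on_support:
  assumes "0 \<le> x" "x \<le> real n"
  shows "\<bar>bspline n x\<bar> \<le> 1 / fact (n - 1) * (\<Sum>j = 0..n. real (n choose j) * real n ^ (n - 1))"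
proof -
  have "\<bar>trunc_pow (n - 1) (x - real j)\<bar> \<le> real n ^ (n - 1)" for j
    using assms by (auto simp: trunc_pow_def intro!: power_mono)
  then have "\<bar>\<Sum>j = 0..n. (-1) ^ j * real (n choose j) * trunc_pow (n - 1) (x - real j)\<bar> \<le>
      (\<Sum>j = 0..n. real (n choose j) * real n ^ (n - 1))"
    by (intro order_trans[OF sum_abs] sum_mono) (auto simp: abs_mult intro!: mult_left_mono)
  then show ?thesis
    by (simp add: bspline_def abs_mult divide_right_mono)
qed

lemma integrable_bspline:
  assumes "n \<ge> 1"
  shows "integrable lborel (bspline n)"
proof (rule integrableI_bounded_set)
  show "{0..real n} \<in> sets lborel" "emeasure lborel {0..real n} < \<infinity>"
    by simp_all
  show "AE x in lborel. x \<in> {0..real n} \<longrightarrow>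
      norm (bspline n x) \<le> 1 / fact (n - 1) * (\<Sum>j = 0..n. real (n choose j) * real n ^ (n - 1))"
    using bspline_bounded_on_support by auto
  show "AE x in lborel. x \<notin> {0..real n} \<longrightarrow> bspline n x = 0"
    using bspline_eq_0_left bspline_eq_0_right[OF assms] by (auto simp: not_le)
qed simp

text \<open>For fixed \<open>x\<close> only the indices k with k at most \<open>x\<close>
  contribute. Arbitrary weights \<open>c\<close> let the lemma also give absolute
  convergence.\<close>

lemma summable_bspline_translates:
  "summable (\<lambda>k. c k * bspline n (x - real k))"
proof (rule summable_finite)
  show "finite {..nat \<lceil>x\<rceil>}"
    by simp
  fix k assume "k \<notin> {..nat \<lceil>x\<rceil>}"
  then have "x < real k"
    by simp linarith
  then show "c k * bspline n (x - real k) = 0"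
    by (simp add: bspline_eq_0_left)
qed

lemma integrable_translate:
  fixes f :: "real \<Rightarrow> 'a::{banach, second_countable_topology}"
  assumes "integrable lborel f"
  shows "integrable lborel (\<lambda>x. f (x - c))"
  using lborel_integrable_real_affine[OF assms, of 1 "- c"] by (simp add: algebra_simps)

lemma integral_translate:
  fixes f :: "real \<Rightarrow> 'a::{banach, second_countable_topology}"
  shows "(LINT x|lborel. f (x - c)) = (LINT x|lborel. f x)"
  using lborel_integral_real_affine[of 1 f "- c"] by (simp add: algebra_simps)

text \<open>Splitting the kernel at \<open>c\<close> turns the rest of the integrand into a
  translate as a whole, so invariance of Lebesgue measure applies. For non-integrable
  \<open>f\<close> both sides are 0 by convention.\<close>

lemma fourier_transform_translate:
  "fourier_transform (\<lambda>x. f (x - c)) \<xi> =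
    exp (- \<i> * of_real \<xi> * of_real c) * fourier_transform f \<xi>"
proof -
  have "fourier_transform (\<lambda>x. f (x - c)) \<xi> =
      (LINT x|lborel. exp (- \<i> * of_real \<xi> * of_real c) *
        (f (x - c) * exp (- \<i> * of_real \<xi> * of_real (x - c))))"
    unfolding fourier_transform_def
    by (intro Bochner_Integration.integral_cong refl)
      (simp add: algebra_simps flip: exp_add)
  also have "\<dots> = exp (- \<i> * of_real \<xi> * of_real c) *
      (LINT x|lborel. f (x - c) * exp (- \<i> * of_real \<xi> * of_real (x - c)))"
    by simp
  also have "(LINT x|lborel. f (x - c) * exp (- \<i> * of_real \<xi> * of_real (x - c))) =
      fourier_transform f \<xi>"
    unfolding fourier_transform_def
    by (rule integral_translate[of "\<lambda>x. f x * exp (- \<i> * of_real \<xi> * of_real x)"])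
  finally show ?thesis .
qed

lemma integrable_fourier_kernel:
  fixes f :: "real \<Rightarrow> complex"
  assumes "integrable lborel f"
  shows "integrable lborel (\<lambda>x. f x * exp (- \<i> * of_real \<xi> * of_real x))"
proof (rule Bochner_Integration.integrable_bound[OF assms])
  show "AE x in lborel. norm (f x * exp (- \<i> * of_real \<xi> * of_real x)) \<le> norm (f x)"
    by (simp add: norm_mult)
qed (use assms in measurable)

text \<open>The kernel has modulus 1, so both absolute summability conditions, pointwise and in the
  L1 norm, pass to the modulated terms and allow termwise integration.\<close>

lemma fourier_transform_sums:
  fixes f :: "nat \<Rightarrow> real \<Rightarrow> complex"
  assumes "\<And>k. integrable lborel (f k)"
    and "\<And>x. summable (\<lambda>k. norm (f k x))"
    and "summable (\<lambda>k. LINT x|lborel. norm (f k x))"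
  shows "(\<lambda>k. fourier_transform (f k) \<xi>) sums fourier_transform (\<lambda>x. \<Sum>k. f k x) \<xi>"
proof -
  have "(\<lambda>k. fourier_transform (f k) \<xi>) sums
      (LINT x|lborel. (\<Sum>k. f k x * exp (- \<i> * of_real \<xi> * of_real x)))"
    unfolding fourier_transform_def
    using assms by (intro sums_integral integrable_fourier_kernel) (simp_all add: norm_mult)
  also have "(\<lambda>x. \<Sum>k. f k x * exp (- \<i> * of_real \<xi> * of_real x)) =
      (\<lambda>x. (\<Sum>k. f k x) * exp (- \<i> * of_real \<xi> * of_real x))"
    by (rule ext) (rule suminf_mult2[symmetric, OF summable_norm_cancel[OF assms(2)]])
  finally show ?thesis
    by (simp add: fourier_transform_def)
qed

theorem theorem9:
  fixes \<alpha> :: real and n :: nat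
  assumes "\<alpha> > 0" and "n \<ge> 1"
  shows "(\<forall>x. summable (\<lambda>k. exp (- \<alpha> * real k) * bspline n (x - real k))) \<and>
    integrable lborel (bspline n) \<and>
    integrable lborel (exp_bspline n \<alpha>) \<and>
    (\<forall>\<xi>::real.
       fourier_transform (\<lambda>x. complex_of_real (exp_bspline n \<alpha> x)) \<xi> =
       fourier_transform (\<lambda>x. complex_of_real (bspline n x)) \<xi> *
         (1 / (1 - exp (- (complex_of_real \<alpha> + \<i> * complex_of_real \<xi>)))))"
proof (intro conjI allI)
  define f where "f k x = exp (- \<alpha> * real k) * bspline n (x - real k)" for k x
  show summable_f: "summable (\<lambda>k. exp (- \<alpha> * real k) * bspline n (x - real k))" for x
    by (rule summable_bspline_translates)
  show int_N: "integrable lborel (bspline n)"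
    using assms(2) by (rule integrable_bspline)
  have int_f: "integrable lborel (f k)" for k
    unfolding f_def by (intro integrable_mult_right integrable_translate int_N)
  have summable_norm_f: "summable (\<lambda>k. norm (f k x))" for x
  proof -
    \<comment> \<open>Writing an absolute value as sign times value moves the sign into the weight,
      so norms form a series of the same shape.\<close>
    have "norm (f k x) = exp (- \<alpha> * real k) * sgn (bspline n (x - real k)) * bspline n (x - real k)" for k
      by (simp add: f_def abs_mult abs_sgn[of "bspline n (x - real k)"])
    then show ?thesis
      by (simp only: summable_bspline_translates)
  qed
  \<comment> \<open>All translates have the same L1 norm, so these integrals form a geometric
    sequence whose ratio is below 1 because \<open>\<alpha>\<close> is positive.\<close>
  have norm_integral_f: "(LINT x|lborel. norm (f k x)) =
      exp (- \<alpha>) ^ k * (LINT x|lborel. \<bar>bspline n x\<bar>)" for k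
    using integral_translate[of "\<lambda>x. \<bar>bspline n x\<bar>" "real k"]
    by (simp add: f_def abs_mult flip: exp_of_nat2_mult)
  have summable_integral_f: "summable (\<lambda>k. LINT x|lborel. norm (f k x))"
    unfolding norm_integral_f using assms(1)
    by (intro summable_mult2 summable_geometric) simp
  show "integrable lborel (exp_bspline n \<alpha>)"
    using integrable_suminf[OF int_f _ summable_integral_f] summable_norm_f
    by (simp add: exp_bspline_def[abs_def] f_def)
  fix \<xi> :: real
  \<comment> \<open>Each unit shift contributes the weight e^(-alpha) and the phase e^(-i xi);
    \<open>q\<close> is their product, of modulus e^(-alpha).\<close>
  define q where "q = exp (- (complex_of_real \<alpha> + \<i> * complex_of_real \<xi>))"
  define F where "F = fourier_transform (\<lambda>x. complex_of_real (bspline n x)) \<xi>"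
  have norm_q: "norm q < 1"
    using assms(1) by (simp add: q_def)
  have series: "(\<lambda>x. \<Sum>k. complex_of_real (f k x)) = (\<lambda>x. complex_of_real (exp_bspline n \<alpha> x))"
    using summable_f by (simp add: f_def exp_bspline_def suminf_of_real)
  have transform_f: "fourier_transform (\<lambda>x. complex_of_real (f k x)) \<xi> = F * q ^ k" for k
  proof -
    have "fourier_transform (\<lambda>x. complex_of_real (f k x)) \<xi> =
        of_real (exp (- \<alpha> * real k)) *
          fourier_transform (\<lambda>x. complex_of_real (bspline n (x - real k))) \<xi>"
      by (simp add: fourier_transform_def f_def mult.assoc)
    also have "\<dots> = of_real (exp (- \<alpha> * real k)) * exp (- \<i> * of_real \<xi> * of_real (real k)) * F"
      by (simp add: F_def mult.assoc
          fourier_transform_translate[of "\<lambda>x. complex_of_real (bspline n x)"])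
    also have "of_real (exp (- \<alpha> * real k)) * exp (- \<i> * of_real \<xi> * of_real (real k)) = q ^ k"
      unfolding q_def exp_of_real[symmetric] exp_add[symmetric] exp_of_nat_mult[symmetric]
      by (rule arg_cong[where f = exp]) (simp add: algebra_simps)
    finally show ?thesis
      by simp
  qed
  have "(\<lambda>k. fourier_transform (\<lambda>x. complex_of_real (f k x)) \<xi>) sums
      fourier_transform (\<lambda>x. \<Sum>k. complex_of_real (f k x)) \<xi>"
    using int_f summable_norm_f summable_integral_f
    by (intro fourier_transform_sums integrable_of_real) (simp_all only: norm_of_real real_norm_def)
  then have "(\<lambda>k. F * q ^ k) sums fourier_transform (\<lambda>x. complex_of_real (exp_bspline n \<alpha> x)) \<xi>"
    by (simp only: transform_f series)
  \<comment> \<open>The same series is summed a second time, now in closed form; uniqueness of the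
    limit identifies the two values.\<close>
  moreover have "(\<lambda>k. F * q ^ k) sums (F * (1 / (1 - q)))"
    using norm_q by (intro sums_mult geometric_sums)
  ultimately show "fourier_transform (\<lambda>x. complex_of_real (exp_bspline n \<alpha> x)) \<xi> =
      fourier_transform (\<lambda>x. complex_of_real (bspline n x)) \<xi> *
        (1 / (1 - exp (- (complex_of_real \<alpha> + \<i> * complex_of_real \<xi>))))"
    unfolding F_def q_def by (rule sums_unique2)
qed

end
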